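(* Let $G$ be a topological group and $A$ a topological $G$-module such that $H^1(G,A)=1$. Then the complements of $A$ in $G\ltimes A$ are conjugate (any two complements are conjugate subgroups of $G\ltimes A$).
   Context: A topological $G$-module $A$ is a topological group (not necessarily abelian) on which $G$ acts continuously on the left by group automorphisms, written ${}^g a$. A continuous derivation is a continuous map $\alpha:G\to A$ with $\alpha(gh)=\alpha(g)\,{}^g\alpha(h)$ for all $g,h\in G$. Two continuous derivations $\alpha,\beta$ are cohomologous if there is $a\in A$ with $\beta(g)=a^{-1}\alpha(g)\,{}^g a$ for all $g\in G$. $H^1(G,A)$ is the set of continuous derivations modulo this relation, with basepoint the class of $g\mapsto 1$; $H^1(G,A)=1$ means it consists of the basepoint only. The topological semidirect product $E=G\ltimes A$ is the set $G\times A$ with the product topology and multiplication $(g,a)(h,b)=(gh,\,{}^{h^{-1}}a\cdot b)$. $G$ and $A$ are viewed as topological subgroups of $E$ via $g\mapsto (g,1)$ and $a\mapsto(1,a)$, so every $e\in E$ is uniquely $e=ga$ with $g\in G,a\in A$, and $gag^{-1}={}^g a$. A complement of $A$ in $E$ is a subgroup $X$ of $E$ such that $E\simeq X\ltimes A$, i.e. such that, with $X$ (subspace topology) acting on $A$ by conjugation, the map $X\ltimes A\to E$, $(x,a)\mapsto xa$, is an isomorphism of topological groups. *)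

theory Defs
  imports "HOL-Analysis.Analysis" "HOL-Algebra.Bij" "HOL-Algebra.Coset"
begin

text \<open>Topological groups are not assumed to be Hausdorff.\<close>

locale topological_group = group G for G (structure) +
  fixes T :: "'a topology"
  assumes topspace_eq: "topspace T = carrier G"
    and continuous_mult: "continuous_map (prod_topology T T) T (\<lambda>(x, y). x \<otimes> y)"
    and continuous_inv: "continuous_map T T (\<lambda>x. inv x)"

locale topological_module =
  G: topological_group G TG + A: topological_group A TA
  for G :: "('g, 'm) monoid_scheme" and TG :: "'g topology"
    and A :: "('a, 'n) monoid_scheme" and TA :: "'a topology" +
  fixes act :: "'g \<Rightarrow> 'a \<Rightarrow> 'a"
  assumes act_hom: "act \<in> hom G (AutoGroup A)"
    and continuous_act: "continuous_map (prod_topology TG TA) TA (\<lambda>(g, a). act g a)"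

text \<open>Derivations are taken extensional, so that two of them are equal as soon as they agree
  on the carrier of \<open>G\<close>.\<close>

definition derivations ::
  "('g, 'm) monoid_scheme \<Rightarrow> 'g topology \<Rightarrow> ('a, 'n) monoid_scheme \<Rightarrow> 'a topology
    \<Rightarrow> ('g \<Rightarrow> 'a \<Rightarrow> 'a) \<Rightarrow> ('g \<Rightarrow> 'a) set" where
  "derivations G TG A TA act =
    {\<alpha> \<in> extensional (carrier G). continuous_map TG TA \<alpha> \<and>
      (\<forall>g\<in>carrier G. \<forall>h\<in>carrier G. \<alpha> (g \<otimes>\<^bsub>G\<^esub> h) = \<alpha> g \<otimes>\<^bsub>A\<^esub> act g (\<alpha> h))}"

definition cohomologous ::
  "('g, 'm) monoid_scheme \<Rightarrow> 'g topology \<Rightarrow> ('a, 'n) monoid_scheme \<Rightarrow> 'a topology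
    \<Rightarrow> ('g \<Rightarrow> 'a \<Rightarrow> 'a) \<Rightarrow> (('g \<Rightarrow> 'a) \<times> ('g \<Rightarrow> 'a)) set" where
  "cohomologous G TG A TA act =
    {(\<alpha>, \<beta>). \<alpha> \<in> derivations G TG A TA act \<and> \<beta> \<in> derivations G TG A TA act \<and>
      (\<exists>a\<in>carrier A. \<forall>g\<in>carrier G. \<beta> g = inv\<^bsub>A\<^esub> a \<otimes>\<^bsub>A\<^esub> \<alpha> g \<otimes>\<^bsub>A\<^esub> act g a)}"

definition H1 ::
  "('g, 'm) monoid_scheme \<Rightarrow> 'g topology \<Rightarrow> ('a, 'n) monoid_scheme \<Rightarrow> 'a topology
    \<Rightarrow> ('g \<Rightarrow> 'a \<Rightarrow> 'a) \<Rightarrow> ('g \<Rightarrow> 'a) set set" where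
  "H1 G TG A TA act = derivations G TG A TA act // cohomologous G TG A TA act"

definition H1_basepoint ::
  "('g, 'm) monoid_scheme \<Rightarrow> 'g topology \<Rightarrow> ('a, 'n) monoid_scheme \<Rightarrow> 'a topology
    \<Rightarrow> ('g \<Rightarrow> 'a \<Rightarrow> 'a) \<Rightarrow> ('g \<Rightarrow> 'a) set" where
  "H1_basepoint G TG A TA act = cohomologous G TG A TA act `` {\<lambda>g\<in>carrier G. \<one>\<^bsub>A\<^esub>}"

text \<open>The pair \<open>(g, a)\<close> stands for the product \<open>g a\<close> and \<open>g a g\<inverse>\<close> is \<open>act g a\<close>; hence
  \<open>g a h b = g h (h\<inverse> a h) b\<close>. The topology of the semidirect product is the product topology.\<close>

definition semidirect ::
  "('g, 'm) monoid_scheme \<Rightarrow> ('a, 'n) monoid_scheme \<Rightarrow> ('g \<Rightarrow> 'a \<Rightarrow> 'a) \<Rightarrow> ('g \<times> 'a) monoid" where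
  "semidirect G A act =
    \<lparr>carrier = carrier G \<times> carrier A,
     mult = (\<lambda>(g, a) (h, b). (g \<otimes>\<^bsub>G\<^esub> h, act (inv\<^bsub>G\<^esub> h) a \<otimes>\<^bsub>A\<^esub> b)),
     one = (\<one>\<^bsub>G\<^esub>, \<one>\<^bsub>A\<^esub>)\<rparr>"

text \<open>Complements of a normal subgroup \<open>N\<close> of a topological group \<open>E\<close> with topology \<open>TE\<close>;
  \<open>K\<close> and \<open>N\<close> carry the subspace topologies.\<close>

definition complement ::
  "('e, 'm) monoid_scheme \<Rightarrow> 'e topology \<Rightarrow> 'e set \<Rightarrow> 'e set \<Rightarrow> bool" where
  "complement E TE N K \<longleftrightarrow>
    subgroup K E \<and>
    (\<lambda>(x, a). x \<otimes>\<^bsub>E\<^esub> a) \<in>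
      iso (semidirect (E\<lparr>carrier := K\<rparr>) (E\<lparr>carrier := N\<rparr>)
            (\<lambda>x. \<lambda>a\<in>N. x \<otimes>\<^bsub>E\<^esub> a \<otimes>\<^bsub>E\<^esub> inv\<^bsub>E\<^esub> x)) E \<and>
    homeomorphic_map (prod_topology (subtopology TE K) (subtopology TE N)) TE
      (\<lambda>(x, a). x \<otimes>\<^bsub>E\<^esub> a)"

end

theory Submission
  imports Defs
begin

text \<open>Each complement \<open>K\<close> of \<open>A\<close> in \<open>G \<ltimes> A\<close> meets the coset \<open>g A\<close> in exactly one
  element \<open>\<delta> g \<cdot> g\<close>, and \<open>\<delta>\<close> is a continuous derivation. As the first cohomology is
  trivial, \<open>\<delta> g = a\<inverse> \<cdot> act g a\<close> for some \<open>a\<close>. Then \<open>\<delta> g \<cdot> g = a\<inverse> g a\<close>, so \<open>K = a\<inverse> G a\<close>.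
  Hence all complements are conjugate to \<open>G\<close>.\<close>

text \<open>Conjugating by \<open>inv e\<close> takes \<open>K\<close> back to \<open>H\<close>, and
  conjugating by \<open>f\<close> then takes \<open>H\<close> to \<open>L\<close>. The computation
  only regroups translations of sets, so \<open>H\<close> may be any subset of the carrier.\<close>

lemma (in group) conjugate_sets_via_common:
  assumes "H \<subseteq> carrier G" "e \<in> carrier G" "f \<in> carrier G"
    and K: "K = e <# H #> inv e" and L: "L = f <# H #> inv f"
  shows "L = (f \<otimes> inv e) <# K #> inv (f \<otimes> inv e)"
proof -
  have sub: "e <# H \<subseteq> carrier G"
    using assms by (intro l_coset_subset_G)
  have K': "K = e <# (H #> inv e)"
    using assms by (simp add: coset_assoc)
  have "(f \<otimes> inv e) <# K = f <# (H #> inv e)"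
    unfolding K' using assms r_coset_subset_G[of H "inv e"]
    by (subst lcos_m_assoc) (simp_all add: m_assoc)
  also have "\<dots> = (f <# H) #> inv e"
    using assms by (simp add: coset_assoc)
  finally have "(f \<otimes> inv e) <# K #> inv (f \<otimes> inv e) = (f <# H) #> (inv e \<otimes> (e \<otimes> inv f))"
    using assms l_coset_subset_G[of H f] by (simp add: coset_mult_assoc inv_mult_group)
  also have "inv e \<otimes> (e \<otimes> inv f) = inv f"
    using assms by (simp add: m_assoc [symmetric])
  finally show ?thesis using L by simp
qed

context topological_module
begin

abbreviation E where "E \<equiv> semidirect G A act"

lemma act_closed [simp]:
  assumes "g \<in> carrier G" "a \<in> carrier A"
  shows "act g a \<in> carrier A"
  using assms act_hom
  by (fastforce simp: hom_def AutoGroup_def auto_def)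

lemma act_mult [simp]:
  assumes "g \<in> carrier G" "a \<in> carrier A" "b \<in> carrier A"
  shows "act g (a \<otimes>\<^bsub>A\<^esub> b) = act g a \<otimes>\<^bsub>A\<^esub> act g b"
  using assms act_hom
  by (fastforce simp: hom_def AutoGroup_def auto_def)

lemma act_act:
  assumes "g \<in> carrier G" "h \<in> carrier G" "a \<in> carrier A"
  shows "act g (act h a) = act (g \<otimes>\<^bsub>G\<^esub> h) a"
proof -
  \<comment> \<open>The product of \<open>BijGroup\<close> is a function restricted to
    \<open>Bij\<close>, so it evaluates to a composition only once both factors are known to lie
    there.\<close>
  have "act g \<in> Bij (carrier A)" "act h \<in> Bij (carrier A)"
    using assms act_hom by (auto simp: hom_def AutoGroup_def auto_def)
  moreover have "act (g \<otimes>\<^bsub>G\<^esub> h) = act g \<otimes>\<^bsub>AutoGroup A\<^esub> act h"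
    using assms act_hom by (simp add: hom_def)
  ultimately show ?thesis
    using assms by (simp add: AutoGroup_def BijGroup_def compose_eq)
qed

lemma act_one_left [simp]:
  assumes "a \<in> carrier A"
  shows "act \<one>\<^bsub>G\<^esub> a = a"
proof -
  have "act \<one>\<^bsub>G\<^esub> = \<one>\<^bsub>AutoGroup A\<^esub>"
    using group_hom.hom_one[of G "AutoGroup A" act] act_hom A.AutoGroup G.group_axioms
    by (simp add: group_hom_def group_hom_axioms_def)
  then show ?thesis
    using assms by (simp add: AutoGroup_def BijGroup_def)
qed

lemma act_inv_act [simp]:
  assumes "g \<in> carrier G" "a \<in> carrier A"
  shows "act (inv\<^bsub>G\<^esub> g) (act g a) = a" "act g (act (inv\<^bsub>G\<^esub> g) a) = a"
  using assms by (simp_all add: act_act)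

lemma act_one_right [simp]:
  assumes "g \<in> carrier G"
  shows "act g \<one>\<^bsub>A\<^esub> = \<one>\<^bsub>A\<^esub>"
  using act_mult[of g "\<one>\<^bsub>A\<^esub>" "\<one>\<^bsub>A\<^esub>"] assms A.r_cancel_one by fastforce

lemma carrier_E: "carrier E = carrier G \<times> carrier A"
  and one_E: "\<one>\<^bsub>E\<^esub> = (\<one>\<^bsub>G\<^esub>, \<one>\<^bsub>A\<^esub>)"
  and mult_E: "(g, a) \<otimes>\<^bsub>E\<^esub> (h, b) = (g \<otimes>\<^bsub>G\<^esub> h, act (inv\<^bsub>G\<^esub> h) a \<otimes>\<^bsub>A\<^esub> b)"
  by (simp_all add: semidirect_def)

lemma group_E: "group E"
proof (rule groupI)
  fix x assume "x \<in> carrier E"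
  then obtain g a where x: "x = (g, a)" "g \<in> carrier G" "a \<in> carrier A"
    by (auto simp: carrier_E)
  \<comment> \<open>The witness comes from rewriting the inverse of g a with the factor from G in
    front: inv a * inv g = inv g * (g * inv a * inv g).\<close>
  then have "(inv\<^bsub>G\<^esub> g, act g (inv\<^bsub>A\<^esub> a)) \<otimes>\<^bsub>E\<^esub> x = \<one>\<^bsub>E\<^esub>"
    by (simp add: mult_E one_E)
  with x show "\<exists>y\<in>carrier E. y \<otimes>\<^bsub>E\<^esub> x = \<one>\<^bsub>E\<^esub>"
    by (intro bexI[of _ "(inv\<^bsub>G\<^esub> g, act g (inv\<^bsub>A\<^esub> a))"]) (auto simp: carrier_E)
qed (auto simp: carrier_E one_E mult_E act_act G.m_assoc A.m_assoc G.inv_mult_group)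

lemma inv_E_A:
  assumes "a \<in> carrier A"
  shows "inv\<^bsub>E\<^esub> (\<one>\<^bsub>G\<^esub>, a) = (\<one>\<^bsub>G\<^esub>, inv\<^bsub>A\<^esub> a)"
  using assms by (intro group.inv_equality[OF group_E]) (auto simp: carrier_E mult_E one_E)

lemma derivation_coboundary:
  assumes "H1 G TG A TA act = {H1_basepoint G TG A TA act}"
    and d: "\<delta> \<in> derivations G TG A TA act"
  obtains a where "a \<in> carrier A"
    and "\<And>g. g \<in> carrier G \<Longrightarrow> \<delta> g = inv\<^bsub>A\<^esub> a \<otimes>\<^bsub>A\<^esub> act g a"
proof -
  let ?R = "cohomologous G TG A TA act"
  have "?R `` {\<delta>} = H1_basepoint G TG A TA act"
    using assms quotientI[OF d, of ?R] by (simp add: H1_def)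
  moreover have "\<delta> g \<in> carrier A" if "g \<in> carrier G" for g
    using d that A.topspace_eq G.topspace_eq
    by (auto simp: derivations_def dest: continuous_map_funspace)
  \<comment> \<open>Reflexivity places \<open>\<delta>\<close> in its own class, which is the class
    of the trivial derivation; this relates the trivial derivation to \<open>\<delta>\<close>, in
    that order.\<close>
  then have "(\<delta>, \<delta>) \<in> ?R"
    using d by (auto simp: cohomologous_def intro!: bexI[of _ "\<one>\<^bsub>A\<^esub>"])
  ultimately have "((\<lambda>g\<in>carrier G. \<one>\<^bsub>A\<^esub>), \<delta>) \<in> ?R"
    by (auto simp: H1_basepoint_def)
  then show ?thesis
    using that by (auto simp: cohomologous_def)
qed

text \<open>The inverse of the homeomorphism from \<open>K\<close> times \<open>A\<close> onto
  \<open>E\<close> yields a continuous section from \<open>G\<close> to \<open>K\<close>. Since a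
  pair (g, b) stands for g b, the element \<open>\<delta> g\<close> * g has second component
  \<open>act (inv g) (\<delta> g)\<close>.\<close>

lemma complement_derivation:
  assumes "complement E (prod_topology TG TA) ({\<one>\<^bsub>G\<^esub>} \<times> carrier A) K"
  obtains \<delta> where "\<delta> \<in> derivations G TG A TA act"
    and "K = (\<lambda>g. (g, act (inv\<^bsub>G\<^esub> g) (\<delta> g))) ` carrier G"
proof -
  interpret E: group E by (rule group_E)
  let ?T = "prod_topology TG TA" and ?N = "{\<one>\<^bsub>G\<^esub>} \<times> carrier A"
  let ?m = "\<lambda>(x, a). x \<otimes>\<^bsub>E\<^esub> a"
  have K: "subgroup K E"
    and hm: "homeomorphic_map (prod_topology (subtopology ?T K) (subtopology ?T ?N)) ?T ?m"
    using assms by (auto simp: complement_def)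
  have top: "topspace ?T = carrier E" "topspace TG = carrier G" "topspace TA = carrier A"
    by (simp_all add: carrier_E G.topspace_eq A.topspace_eq)
  have KE: "K \<subseteq> carrier E"
    using K by (rule subgroup.subset)
  obtain q where q: "homeomorphic_maps (prod_topology (subtopology ?T K) (subtopology ?T ?N)) ?T ?m q"
    using hm homeomorphic_map_maps by blast
  \<comment> \<open>This is the factor x in the unique factorization g = x a with x in
    \<open>K\<close> and a in \<open>A\<close>; it inherits continuity from
    \<open>q\<close>.\<close>
  define s where "s g = fst (q (g, \<one>\<^bsub>A\<^esub>))" for g
  have "continuous_map TG ?T (\<lambda>g. (g, \<one>\<^bsub>A\<^esub>))"
    by (simp add: continuous_map_pairwise o_def top)
  moreover have qc: "continuous_map ?T (prod_topology (subtopology ?T K) (subtopology ?T ?N)) q"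
    using q by (simp add: homeomorphic_maps_def)
  ultimately have "continuous_map TG (prod_topology (subtopology ?T K) (subtopology ?T ?N))
      (\<lambda>g. q (g, \<one>\<^bsub>A\<^esub>))"
    using continuous_map_compose[of TG ?T "\<lambda>g. (g, \<one>\<^bsub>A\<^esub>)" _ q] by (simp add: o_def)
  then have sc: "continuous_map TG (subtopology ?T K) s"
    unfolding s_def by (rule continuous_map_fst_of[unfolded o_def])
  have sK: "s g \<in> K" if "g \<in> carrier G" for g
    using continuous_map_funspace[OF sc] that by (auto simp: top)
  \<comment> \<open>The factor from \<open>?N\<close> has trivial first component, so multiplying by
    it leaves the first component of \<open>s g\<close> unchanged.\<close>
  have fst_s: "fst (s g) = g" if g: "g \<in> carrier G" for g
  proof -
    have "q (g, \<one>\<^bsub>A\<^esub>) \<in> topspace (prod_topology (subtopology ?T K) (subtopology ?T ?N))"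
      using continuous_map_funspace[OF qc] g by (auto simp: top carrier_E)
    moreover have "?m (q (g, \<one>\<^bsub>A\<^esub>)) = (g, \<one>\<^bsub>A\<^esub>)"
      using q g by (auto simp: homeomorphic_maps_def top)
    ultimately show ?thesis
      unfolding s_def
      by (cases "q (g, \<one>\<^bsub>A\<^esub>)") (auto simp: mult_E top G.topspace_eq)
  qed
  have K_unique: "a = b" if "(g, a) \<in> K" "(g, b) \<in> K" for g a b
  proof -
    have c: "g \<in> carrier G" "a \<in> carrier A" "b \<in> carrier A"
      using that KE by (auto simp: carrier_E)
    have "inj_on ?m (topspace (prod_topology (subtopology ?T K) (subtopology ?T ?N)))"
      using hm by (rule homeomorphic_imp_injective_map)
    \<comment> \<open>Two elements of \<open>K\<close> over the same g differ by a right factor from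
      \<open>?N\<close>; these are two factorizations of (g, b), which must coincide.\<close>
    moreover have "?m ((g, a), (\<one>\<^bsub>G\<^esub>, inv\<^bsub>A\<^esub> a \<otimes>\<^bsub>A\<^esub> b)) = ?m ((g, b), (\<one>\<^bsub>G\<^esub>, \<one>\<^bsub>A\<^esub>))"
      using c by (simp add: mult_E A.m_assoc[symmetric])
    ultimately have "((g, a), (\<one>\<^bsub>G\<^esub>, inv\<^bsub>A\<^esub> a \<otimes>\<^bsub>A\<^esub> b)) = ((g, b), (\<one>\<^bsub>G\<^esub>, \<one>\<^bsub>A\<^esub>))"
      by (rule inj_onD) (use that c in \<open>auto simp: top\<close>)
    then show ?thesis by simp
  qed
  define \<alpha> where "\<alpha> g = snd (s g)" for g
  have gK: "(g, \<alpha> g) \<in> K" if "g \<in> carrier G" for g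
    using sK[OF that] fst_s[OF that] by (metis \<alpha>_def prod.collapse)
  have \<alpha>A: "\<alpha> g \<in> carrier A" if "g \<in> carrier G" for g
    using gK[OF that] KE by (auto simp: carrier_E)
  \<comment> \<open>The product of the elements of \<open>K\<close> over g and h is again in
    \<open>K\<close> and lies over the product of g and h, where \<open>K\<close> has only one
    element.\<close>
  have \<alpha>_mult: "\<alpha> (g \<otimes>\<^bsub>G\<^esub> h) = act (inv\<^bsub>G\<^esub> h) (\<alpha> g) \<otimes>\<^bsub>A\<^esub> \<alpha> h"
    if "g \<in> carrier G" "h \<in> carrier G" for g h
  proof (rule K_unique)
    show "(g \<otimes>\<^bsub>G\<^esub> h, \<alpha> (g \<otimes>\<^bsub>G\<^esub> h)) \<in> K"
      using that by (intro gK) simp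
    show "(g \<otimes>\<^bsub>G\<^esub> h, act (inv\<^bsub>G\<^esub> h) (\<alpha> g) \<otimes>\<^bsub>A\<^esub> \<alpha> h) \<in> K"
      using subgroup.m_closed[OF K gK[OF that(1)] gK[OF that(2)]] by (simp add: mult_E)
  qed
  \<comment> \<open>Acting by g moves the factor from \<open>A\<close> to the left of g, which turns
    the twisted rule \<open>\<alpha>_mult\<close> into the derivation law.\<close>
  define \<delta> where "\<delta> = (\<lambda>g\<in>carrier G. act g (\<alpha> g))"
  have "continuous_map TG TA \<alpha>"
    unfolding \<alpha>_def using sc
    by (intro continuous_map_snd_of[where X = TG, unfolded o_def])
      (simp add: continuous_map_in_subtopology)
  then have "continuous_map TG (prod_topology TG TA) (\<lambda>g. (g, \<alpha> g))"
    by (simp add: continuous_map_pairwise o_def)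
  from continuous_map_compose[OF this continuous_act]
  have "continuous_map TG TA (\<lambda>g. act g (\<alpha> g))"
    by (simp add: o_def)
  then have "continuous_map TG TA \<delta>"
    by (rule continuous_map_eq) (simp add: \<delta>_def top)
  moreover have "\<delta> (g \<otimes>\<^bsub>G\<^esub> h) = \<delta> g \<otimes>\<^bsub>A\<^esub> act g (\<delta> h)"
    if "g \<in> carrier G" "h \<in> carrier G" for g h
    using that \<alpha>A by (simp add: \<delta>_def \<alpha>_mult act_act G.m_assoc)
  ultimately have "\<delta> \<in> derivations G TG A TA act"
    by (auto simp: derivations_def \<delta>_def)
  moreover have "K = (\<lambda>g. (g, \<alpha> g)) ` carrier G"
  proof (intro equalityI subsetI)
    fix x assume x: "x \<in> K"
    with KE obtain g a where ga: "x = (g, a)" "g \<in> carrier G"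
      by (auto simp: carrier_E)
    with x have "a = \<alpha> g"
      using gK by (blast intro: K_unique)
    with ga show "x \<in> (\<lambda>g. (g, \<alpha> g)) ` carrier G"
      by simp
  qed (use gK in auto)
  then have "K = (\<lambda>g. (g, act (inv\<^bsub>G\<^esub> g) (\<delta> g))) ` carrier G"
    using \<alpha>A by (simp add: \<delta>_def)
  ultimately show ?thesis by (rule that)
qed

text \<open>The standard copy of \<open>G\<close> serves as the common reference to which every
  complement is compared.\<close>

lemma complement_conjugate_to_G:
  assumes "H1 G TG A TA act = {H1_basepoint G TG A TA act}"
    and "complement E (prod_topology TG TA) ({\<one>\<^bsub>G\<^esub>} \<times> carrier A) K"
  shows "\<exists>e\<in>carrier E. K = e <#\<^bsub>E\<^esub> (carrier G \<times> {\<one>\<^bsub>A\<^esub>}) #>\<^bsub>E\<^esub> inv\<^bsub>E\<^esub> e"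
proof -
  obtain \<delta> where d: "\<delta> \<in> derivations G TG A TA act"
    and K: "K = (\<lambda>g. (g, act (inv\<^bsub>G\<^esub> g) (\<delta> g))) ` carrier G"
    using assms(2) by (rule complement_derivation)
  obtain a where a: "a \<in> carrier A"
    and da: "\<And>g. g \<in> carrier G \<Longrightarrow> \<delta> g = inv\<^bsub>A\<^esub> a \<otimes>\<^bsub>A\<^esub> act g a"
    using derivation_coboundary[OF assms(1) d] by blast
  \<comment> \<open>Conjugating g by the inverse of a gives inv a * g * a = (inv a *
    \<open>act g a\<close>) * g = \<open>\<delta> g\<close> * g, the element of \<open>K\<close>
    over g.\<close>
  let ?e = "(\<one>\<^bsub>G\<^esub>, inv\<^bsub>A\<^esub> a)"
  have "?e <#\<^bsub>E\<^esub> (carrier G \<times> {\<one>\<^bsub>A\<^esub>}) #>\<^bsub>E\<^esub> inv\<^bsub>E\<^esub> ?e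
      = (\<lambda>g. ?e \<otimes>\<^bsub>E\<^esub> (g, \<one>\<^bsub>A\<^esub>) \<otimes>\<^bsub>E\<^esub> inv\<^bsub>E\<^esub> ?e) ` carrier G"
    by (auto simp: l_coset_def r_coset_def)
  also have "\<dots> = K"
    unfolding K using a by (intro image_cong) (simp_all add: da inv_E_A mult_E)
  finally show ?thesis
    using a by (intro bexI[of _ ?e]) (auto simp: carrier_E)
qed

end

theorem corollary6p3:
  fixes G :: "('g, 'm) monoid_scheme" and TG :: "'g topology"
    and A :: "('a, 'n) monoid_scheme" and TA :: "'a topology"
    and act :: "'g \<Rightarrow> 'a \<Rightarrow> 'a"
    and K L :: "('g \<times> 'a) set"
  assumes "topological_module G TG A TA act"
    and "H1 G TG A TA act = {H1_basepoint G TG A TA act}"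
    and "complement (semidirect G A act) (prod_topology TG TA) ({\<one>\<^bsub>G\<^esub>} \<times> carrier A) K"
    and "complement (semidirect G A act) (prod_topology TG TA) ({\<one>\<^bsub>G\<^esub>} \<times> carrier A) L"
  shows "\<exists>e\<in>carrier (semidirect G A act).
           L = e <#\<^bsub>semidirect G A act\<^esub> K #>\<^bsub>semidirect G A act\<^esub> inv\<^bsub>semidirect G A act\<^esub> e"
proof -
  interpret topological_module G TG A TA act by (rule assms)
  interpret E: group E by (rule group_E)
  obtain e f where "e \<in> carrier E" "K = e <#\<^bsub>E\<^esub> (carrier G \<times> {\<one>\<^bsub>A\<^esub>}) #>\<^bsub>E\<^esub> inv\<^bsub>E\<^esub> e"
    and "f \<in> carrier E" "L = f <#\<^bsub>E\<^esub> (carrier G \<times> {\<one>\<^bsub>A\<^esub>}) #>\<^bsub>E\<^esub> inv\<^bsub>E\<^esub> f"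
    using complement_conjugate_to_G assms(2-4) by meson
  moreover have "carrier G \<times> {\<one>\<^bsub>A\<^esub>} \<subseteq> carrier E"
    by (auto simp: carrier_E)
  ultimately show ?thesis
    by (intro bexI[of _ "f \<otimes>\<^bsub>E\<^esub> inv\<^bsub>E\<^esub> e"] E.conjugate_sets_via_common) simp_all
qed

end
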